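(* For every three integers $n\geq r\geq k\geq 2$ the inequality $$ f(n,k,r) \geq \frac{\binom{n}{k}}{\binom{r}{k}}\cdot \frac{r-k+2}{n-k+2}$$ holds.
   Context: A $k$-partition of a finite set $X$ is a partition $\mathcal{P}=(X_1,\dots,X_k)$ of $X$ into precisely $k$ nonempty classes. An $r$-element set $H\subseteq X$ crosses $\mathcal{P}$ if $H$ intersects exactly $\min(r,k)$ of the classes. A hypergraph (set of subsets of $X$) crosses $\mathcal{P}$ if at least one of its members does. For integers $n\ge k$, $n\ge r$, $f(n,k,r)$ denotes the minimum number of edges of an $r$-uniform hypergraph $\mathcal{H}\subseteq\binom{X}{r}$ on an $n$-element set $X$ that crosses every $k$-partition of $X$. *)

theory Defs
  imports Complex_Main "HOL-Library.Disjoint_Sets"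
begin

definition k_partition :: "nat \<Rightarrow> 'a set \<Rightarrow> 'a set set \<Rightarrow> bool" where
  "k_partition k X P \<longleftrightarrow> partition_on X P \<and> card P = k"

definition edge_crosses :: "'a set \<Rightarrow> 'a set set \<Rightarrow> bool" where
  "edge_crosses e P \<longleftrightarrow> card {C \<in> P. e \<inter> C \<noteq> {}} = min (card e) (card P)"

definition hypergraph_crosses :: "'a set set \<Rightarrow> 'a set set \<Rightarrow> bool" where
  "hypergraph_crosses H P \<longleftrightarrow> (\<exists>e\<in>H. edge_crosses e P)"

definition uniform_hypergraph :: "nat \<Rightarrow> 'a set \<Rightarrow> 'a set set \<Rightarrow> bool" where
  "uniform_hypergraph r X H \<longleftrightarrow> H \<subseteq> {e. e \<subseteq> X \<and> card e = r}"

definition crosses_all_k_partitions :: "nat \<Rightarrow> 'a set \<Rightarrow> 'a set set \<Rightarrow> bool" where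
  "crosses_all_k_partitions k X H \<longleftrightarrow> (\<forall>P. k_partition k X P \<longrightarrow> hypergraph_crosses H P)"

text \<open>
  The ground set is fixed to be \<open>{..<n}\<close>; the lemma \<open>min_crossing_edges_eq\<close> below
  shows that any other set with \<open>n\<close> elements gives the same number, and the lemma
  \<open>crossing_hypergraph_exists\<close> shows that the minimum is over a nonempty set
  whenever \<open>k \<le> n\<close> and \<open>r \<le> n\<close>.
\<close>

definition min_crossing_edges :: "nat \<Rightarrow> nat \<Rightarrow> nat \<Rightarrow> nat" where
  "min_crossing_edges n k r = (LEAST m. \<exists>H. uniform_hypergraph r {..<n} H \<and>
     crosses_all_k_partitions k {..<n} H \<and> card H = m)"

lemma crossing_hypergraph_transfer:
  assumes g: "bij_betw g X Y"
    and H: "uniform_hypergraph r X H" "crosses_all_k_partitions k X H"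
  shows "\<exists>H'. uniform_hypergraph r Y H' \<and> crosses_all_k_partitions k Y H' \<and> card H' = card H"
proof (intro exI conjI)
  have inj: "inj_on g X" and im: "g ` X = Y"
    using g by (auto simp: bij_betw_def)
  have sub: "e \<subseteq> X" "card e = r" if "e \<in> H" for e
    using H(1) that by (auto simp: uniform_hypergraph_def)
  let ?H = "(\<lambda>e. g ` e) ` H"
  have card_im: "card (g ` e) = card e" if "e \<subseteq> X" for e
    using inj that by (meson card_image inj_on_subset)
  show "uniform_hypergraph r Y ?H"
    using sub im card_im by (fastforce simp: uniform_hypergraph_def)
  have "inj_on (\<lambda>e. g ` e) (Pow X)"
    using inj by (simp add: inj_on_image_Pow)
  then show "card ?H = card H"
    by (meson Pow_iff card_image inj_on_subset sub(1) subsetI)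
  show "crosses_all_k_partitions k Y ?H"
    unfolding crosses_all_k_partitions_def
  proof (intro allI impI)
    fix P assume P: "k_partition k Y P"
    let ?b = "\<lambda>C. X \<inter> g -` C"
    have PY: "partition_on Y P" using P by (simp add: k_partition_def)
    have CY: "C \<subseteq> Y" "C \<noteq> {}" if "C \<in> P" for C
      using PY that by (auto simp: partition_on_def)
    have gb: "g ` ?b C = C" if "C \<in> P" for C
      using CY[OF that] im by auto
    have inj_b: "inj_on ?b P"
      by (rule inj_onI) (metis gb)
    have "partition_on X (?b ` P)"
    proof (rule partition_onI)
      show "\<Union> (?b ` P) = X"
        using PY im by (auto simp: partition_on_def)
      show "disjnt p q" if "p \<in> ?b ` P" "q \<in> ?b ` P" "p \<noteq> q" for p q
        using that PY unfolding partition_on_def disjoint_def disjnt_def by blast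
      show "{} \<notin> ?b ` P"
        using gb CY(2) by (metis (no_types, lifting) image_empty imageE)
    qed
    then have "k_partition k X (?b ` P)"
      using P card_image[OF inj_b] by (simp add: k_partition_def)
    then obtain e where e: "e \<in> H" "edge_crosses e (?b ` P)"
      using H(2) by (auto simp: crosses_all_k_partitions_def hypergraph_crosses_def)
    have "{D \<in> ?b ` P. e \<inter> D \<noteq> {}} = ?b ` {C \<in> P. g ` e \<inter> C \<noteq> {}}"
      using sub(1)[OF e(1)] by blast
    moreover have "inj_on ?b {C \<in> P. g ` e \<inter> C \<noteq> {}}"
      using inj_b by (rule inj_on_subset) auto
    ultimately have "card {D \<in> ?b ` P. e \<inter> D \<noteq> {}} = card {C \<in> P. g ` e \<inter> C \<noteq> {}}"
      by (simp add: card_image)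
    then have "edge_crosses (g ` e) P"
      using e(2) card_image[OF inj_b] card_im[OF sub(1)[OF e(1)]]
      by (simp add: edge_crosses_def)
    then show "hypergraph_crosses ?H P"
      using e(1) by (auto simp: hypergraph_crosses_def)
  qed
qed

lemma min_crossing_edges_eq:
  assumes "finite X" "card X = n"
  shows "min_crossing_edges n k r = (LEAST m. \<exists>H. uniform_hypergraph r X H \<and>
     crosses_all_k_partitions k X H \<and> card H = m)"
proof -
  obtain g where g: "bij_betw g {..<n} X"
    using assms by (metis card_lessThan finite_lessThan finite_same_card_bij)
  note g' = bij_betw_inv_into[OF g]
  have "(\<exists>H. uniform_hypergraph r {..<n} H \<and> crosses_all_k_partitions k {..<n} H \<and> card H = m)
    \<longleftrightarrow> (\<exists>H. uniform_hypergraph r X H \<and> crosses_all_k_partitions k X H \<and> card H = m)" for m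
    using crossing_hypergraph_transfer[OF g, of r _ k] crossing_hypergraph_transfer[OF g', of r _ k]
    by blast
  then show ?thesis
    by (simp add: min_crossing_edges_def)
qed

lemma crossing_hypergraph_exists:
  assumes X: "finite X" and r: "r \<le> card X"
  shows "\<exists>H. uniform_hypergraph r X H \<and> crosses_all_k_partitions k X H"
proof (intro exI conjI)
  let ?H = "{e. e \<subseteq> X \<and> card e = r}"
  show "uniform_hypergraph r X ?H"
    by (simp add: uniform_hypergraph_def)
  show "crosses_all_k_partitions k X ?H"
    unfolding crosses_all_k_partitions_def
  proof (intro allI impI)
    fix P assume "k_partition k X P"
    then have P: "partition_on X P" and cP: "card P = k"
      by (auto simp: k_partition_def)
    have finP: "finite P"
      using finite_elements[OF X P] .
    have "\<forall>C\<in>P. \<exists>x. x \<in> C"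
      using P by (metis all_not_in_conv partition_onD3)
    then obtain s where s: "\<And>C. C \<in> P \<Longrightarrow> s C \<in> C"
      by metis
    have uniq: "C = D" if "C \<in> P" "D \<in> P" "x \<in> C" "x \<in> D" for C D x
      using P that by (auto simp: partition_on_def disjoint_def)
    have inj: "inj_on s P"
      by (rule inj_onI) (metis s uniq)
    have sX: "s ` P \<subseteq> X"
      using s P by (auto simp: partition_on_def)
    have "\<exists>e. e \<subseteq> X \<and> card e = r \<and> edge_crosses e P"
    proof (cases "r \<le> k")
      case True
      then obtain Q where Q: "Q \<subseteq> P" "card Q = r"
        using cP by (meson obtain_subset_with_card_n)
      have "card (s ` Q) = r"
        using Q inj by (metis card_image inj_on_subset)
      moreover have "{C \<in> P. s ` Q \<inter> C \<noteq> {}} = Q"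
        using Q(1) s uniq by blast
      ultimately show ?thesis
        using Q True sX cP by (intro exI[of _ "s ` Q"]) (auto simp: edge_crosses_def)
    next
      case False
      have "card (s ` P) = k"
        using inj cP by (simp add: card_image)
      then obtain e where e: "s ` P \<subseteq> e" "e \<subseteq> X" "card e = r"
        using False r sX X exists_subset_between[of "s ` P" r X] by auto
      have "{C \<in> P. e \<inter> C \<noteq> {}} = P"
        using e(1) s by blast
      then show ?thesis
        using e False cP by (intro exI[of _ e]) (auto simp: edge_crosses_def)
    qed
    then show "hypergraph_crosses ?H P"
      by (auto simp: hypergraph_crosses_def)
  qed
qed

end

theory Submission
  imports Defs
begin

text \<open>
  Fix a set \<open>S\<close> of \<open>k - 2\<close> vertices, and consider only those \<open>k\<close>-partitions in which every
  element of \<open>S\<close> is a class of its own; such a partition amounts to a splitting of \<open>X - S\<close>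
  into two nonempty parts. Since \<open>r \<ge> k\<close>, an edge crosses it only if it meets all the classes,
  that is, if it contains \<open>S\<close> and meets both parts. Hence the edges through \<open>S\<close>, restricted to
  \<open>X - S\<close>, form a connected hypergraph on \<open>n - k + 2\<close> vertices with edges of size \<open>r - k + 2\<close>,
  and a connected hypergraph needs at least \<open>(n - k + 1) / (r - k + 1)\<close> such edges
  (\<open>connected_hypergraph_card_le\<close>): each edge added to a connected piece brings in at most
  \<open>r - k + 1\<close> new vertices.

  Each edge contains \<open>r choose (k - 2)\<close> of the sets \<open>S\<close>, so summing the bound over all \<open>S\<close>
  gives
  \<open>card H * (r choose (k - 2)) \<ge> (n choose (k - 2)) * (n - k + 1) / (r - k + 1)\<close>, which the absorption identity
  \<open>k (k - 1) (n choose k) = (n - k + 2) (n - k + 1) (n choose (k - 2))\<close> turns into the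
  claimed form.
\<close>

text \<open>
  Grow a set of vertices from a single one by adding edges that meet it: each edge contributes
  at most \<open>s\<close> new vertices, as one of its at most \<open>s + 1\<close> vertices is already there. A
  growth with the most edges covers \<open>Y\<close>, as otherwise some edge leaves the covered set and
  extends it. Edges may stick out of \<open>Y\<close>, so that the bound applies directly to the edges
  through a fixed vertex set, without passing to their traces.
\<close>

lemma connected_hypergraph_card_le:
  assumes Y: "finite Y" and F: "finite F"
    and size: "\<And>e. e \<in> F \<Longrightarrow> card (e \<inter> Y) \<le> Suc s"
    and connected: "\<And>A. A \<subseteq> Y \<Longrightarrow> A \<noteq> {} \<Longrightarrow> A \<noteq> Y \<Longrightarrow>
      \<exists>e\<in>F. e \<inter> A \<noteq> {} \<and> e \<inter> (Y - A) \<noteq> {}"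
  shows "card Y \<le> Suc (card F * s)"
proof (cases "Y = {}")
  case False
  then obtain y where y: "y \<in> Y" by blast
  define reaches where "reaches M U \<longleftrightarrow> M \<subseteq> F \<and> U \<subseteq> Y \<and> U \<noteq> {} \<and>
    (\<forall>e\<in>M. e \<inter> Y \<subseteq> U) \<and> card U \<le> Suc (card M * s)" for M U
  have start: "\<exists>U. reaches {} U"
    using y by (intro exI[of _ "{y}"]) (auto simp: reaches_def)
  have bounded: "\<forall>M. (\<exists>U. reaches M U) \<longrightarrow> card M < Suc (card F)"
    using F by (auto simp: reaches_def less_Suc_eq_le card_mono)
  obtain M where M: "\<exists>U. reaches M U"
    and longest: "\<And>M'. \<exists>U. reaches M' U \<Longrightarrow> card M' \<le> card M"
    using ex_has_greatest_nat[of "\<lambda>M. \<exists>U. reaches M U" "{}" card "Suc (card F)"] start bounded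
    by blast
  then obtain U where U: "reaches M U" by blast
  have finM: "finite M" and finU: "finite U"
    using U F Y by (auto simp: reaches_def intro: finite_subset)
  have "U = Y"
  \<comment> \<open>An edge that leaves \<open>U\<close> is not yet in \<open>M\<close>, so adding it contradicts the maximality of \<open>M\<close>.\<close>
  proof (rule ccontr)
    assume "U \<noteq> Y"
    then obtain e where e: "e \<in> F" "e \<inter> U \<noteq> {}" "e \<inter> (Y - U) \<noteq> {}"
      using connected U unfolding reaches_def by meson
    have new: "e \<notin> M"
      using e U by (auto simp: reaches_def)
    have "card (U \<union> (e \<inter> Y)) + card (U \<inter> (e \<inter> Y)) = card U + card (e \<inter> Y)"
      using card_Un_Int[of U "e \<inter> Y"] finU Y by simp
    moreover have "card (U \<inter> (e \<inter> Y)) \<ge> 1"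
      using e U finU by (auto simp: reaches_def Suc_le_eq card_gt_0_iff)
    ultimately have "card (U \<union> (e \<inter> Y)) \<le> Suc (card M * s) + s"
      using size[OF e(1)] U by (simp add: reaches_def)
    then have "reaches (insert e M) (U \<union> (e \<inter> Y))"
      using U e(1) new finM by (auto simp: reaches_def)
    then have "card (insert e M) \<le> card M"
      using longest by blast
    then show False
      using new finM by simp
  qed
  moreover have "card M * s \<le> card F * s"
    using U F by (intro mult_right_mono card_mono) (auto simp: reaches_def)
  ultimately show ?thesis
    using U by (auto simp: reaches_def intro: le_trans)
qed simp

lemma partition_on_singletons_and_split:
  assumes "finite S" "S \<subseteq> X" "A \<subseteq> X - S" "A \<noteq> {}" "A \<noteq> X - S"
  shows "k_partition (card S + 2) X (insert A (insert (X - S - A) ((\<lambda>x. {x}) ` S)))"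
proof -
  have "card ((\<lambda>x. {x}) ` S) = card S"
    by (simp add: card_image)
  moreover have "A \<noteq> X - S - A" "A \<notin> (\<lambda>x. {x}) ` S" "X - S - A \<notin> (\<lambda>x. {x}) ` S"
    using assms by auto
  moreover have "partition_on X (insert A (insert (X - S - A) ((\<lambda>x. {x}) ` S)))"
    using assms by (intro partition_onI) (auto simp: disjnt_def)
  ultimately show ?thesis
    using assms(1) by (simp add: k_partition_def)
qed

lemma edge_crosses_meets_all_classes:
  assumes "edge_crosses e P" "finite P" "card P \<le> card e" "C \<in> P"
  shows "e \<inter> C \<noteq> {}"
proof -
  have "{C \<in> P. e \<inter> C \<noteq> {}} = P"
    using assms by (intro card_subset_eq) (auto simp: edge_crosses_def)
  then show ?thesis
    using assms(4) by blast
qed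

text \<open>
  Splitting off the elements of \<open>S\<close> as singleton classes forces every crossing edge to contain
  \<open>S\<close>, which makes the edges through \<open>S\<close> a connected hypergraph on \<open>X - S\<close>.
\<close>

lemma card_edges_containing_ge:
  assumes X: "finite X" and H: "uniform_hypergraph r X H"
    and crosses: "crosses_all_k_partitions (d + 2) X H" and r: "d + 2 \<le> r"
    and S: "S \<subseteq> X" "card S = d"
  shows "card X - d - 1 \<le> card {e \<in> H. S \<subseteq> e} * (r - d - 1)"
proof -
  have edge: "e \<subseteq> X" "card e = r" if "e \<in> H" for e
    using H that by (auto simp: uniform_hypergraph_def)
  have finH: "finite H"
    by (rule finite_subset[of _ "Pow X"]) (use edge X in auto)
  have finS: "finite S"
    using S X finite_subset by blast
  have "card (X - S) \<le> Suc (card {e \<in> H. S \<subseteq> e} * (r - d - 1))"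
  proof (rule connected_hypergraph_card_le)
    fix e assume e: "e \<in> {e \<in> H. S \<subseteq> e}"
    then have "e \<inter> (X - S) = e - S"
      using edge by blast
    then show "card (e \<inter> (X - S)) \<le> Suc (r - d - 1)"
      using e edge(2)[of e] S finS by (simp add: card_Diff_subset)
  next
    fix A assume A: "A \<subseteq> X - S" "A \<noteq> {}" "A \<noteq> X - S"
    define P where "P = insert A (insert (X - S - A) ((\<lambda>x. {x}) ` S))"
    have P: "k_partition (d + 2) X P"
      using partition_on_singletons_and_split[OF finS S(1) A] S(2) by (simp add: P_def)
    then obtain e where e: "e \<in> H" "edge_crosses e P"
      using crosses by (auto simp: crosses_all_k_partitions_def hypergraph_crosses_def)
    have "e \<inter> C \<noteq> {}" if "C \<in> P" for C
      by (rule edge_crosses_meets_all_classes[OF e(2) _ _ that])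
        (use P r edge(2)[OF e(1)] finS in \<open>auto simp: P_def k_partition_def\<close>)
    then have "e \<inter> A \<noteq> {}" "e \<inter> (X - S - A) \<noteq> {}" "S \<subseteq> e"
      unfolding P_def by blast+
    then show "\<exists>e\<in>{e \<in> H. S \<subseteq> e}. e \<inter> A \<noteq> {} \<and> e \<inter> (X - S - A) \<noteq> {}"
      using e(1) by blast
  qed (use X finH in auto)
  then show ?thesis
    using S finS by (simp add: card_Diff_subset)
qed

text \<open>
  Count the pairs \<open>S \<subseteq> e\<close> with \<open>card S = d\<close> and \<open>e \<in> H\<close>: by \<open>S\<close> there are many, since
  the edges through \<open>S\<close> connect \<open>X - S\<close>, and by \<open>e\<close> there are \<open>r choose d\<close> for each edge.
\<close>

lemma card_crossing_hypergraph_times_binomial_ge: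
  assumes X: "finite X" and H: "uniform_hypergraph r X H"
    and crosses: "crosses_all_k_partitions (d + 2) X H" and r: "d + 2 \<le> r"
  shows "(card X choose d) * (card X - d - 1) \<le> card H * (r choose d) * (r - d - 1)"
proof -
  define subsets where "subsets = {S. S \<subseteq> X \<and> card S = d}"
  have edge: "e \<subseteq> X" "card e = r" if "e \<in> H" for e
    using H that by (auto simp: uniform_hypergraph_def)
  have finH: "finite H"
    by (rule finite_subset[of _ "Pow X"]) (use edge X in auto)
  have fin: "finite subsets"
    using X by (simp add: subsets_def)
  have in_edge: "card {S \<in> subsets. S \<subseteq> e} = r choose d" if "e \<in> H" for e
  proof -
    have "{S \<in> subsets. S \<subseteq> e} = {S. S \<subseteq> e \<and> card S = d}"
      using edge[OF that] by (auto simp: subsets_def)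
    then show ?thesis
      using edge[OF that] X finite_subset by (metis n_subsets)
  qed
  have "(card X choose d) * (card X - d - 1) = (\<Sum>S\<in>subsets. card X - d - 1)"
    using X by (simp add: subsets_def n_subsets)
  also have "\<dots> \<le> (\<Sum>S\<in>subsets. card {e \<in> H. S \<subseteq> e} * (r - d - 1))"
    using card_edges_containing_ge[OF assms] by (intro sum_mono) (simp add: subsets_def)
  also have "\<dots> = (\<Sum>S\<in>subsets. \<Sum>e\<in>{e \<in> H. S \<subseteq> e}. 1) * (r - d - 1)"
    by (simp add: sum_distrib_right)
  also have "(\<Sum>S\<in>subsets. \<Sum>e\<in>{e \<in> H. S \<subseteq> e}. 1) = (\<Sum>e\<in>H. \<Sum>S\<in>{S \<in> subsets. S \<subseteq> e}. 1::nat)"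
    by (rule sum.swap_restrict[OF fin finH])
  also have "\<dots> = card H * (r choose d)"
    using in_edge by simp
  finally show ?thesis .
qed

lemma binomial_absorb_twice:
  assumes "d + 2 \<le> m"
  shows "real (m choose (d + 2)) * ((real d + 2) * (real d + 1)) =
    real (m choose d) * (real m - real d) * (real m - real d - 1)"
proof -
  have absorb: "real (m choose Suc j) * (real j + 1) = real (m choose j) * (real m - real j)"
    if "j \<le> m" for j
    using gbinomial_absorb_comp[of "real m" j] gbinomial_absorption[of j "real m"]
    by (simp add: binomial_gbinomial algebra_simps)
  have "real (m choose (d + 2)) * (real d + 2) = real (m choose Suc d) * (real m - real d - 1)"
    using absorb[of "Suc d"] assms by (simp add: algebra_simps)
  then have "real (m choose (d + 2)) * (real d + 2) * (real d + 1) =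
      real (m choose Suc d) * (real d + 1) * (real m - real d - 1)"
    by (simp add: mult_ac)
  then show ?thesis
    using absorb[of d] assms by (simp add: mult.assoc)
qed

theorem corollary9:
  fixes n r k :: nat
  assumes "n \<ge> r" and "r \<ge> k" and "k \<ge> 2"
  shows "real (min_crossing_edges n k r) \<ge>
    real (n choose k) / real (r choose k) * ((real r - real k + 2) / (real n - real k + 2))"
proof -
  obtain d where k: "k = d + 2"
    using assms(3) by (metis add.commute le_Suc_ex)
  have "\<exists>m H. uniform_hypergraph r {..<n} H \<and> crosses_all_k_partitions k {..<n} H \<and> card H = m"
    using crossing_hypergraph_exists[of "{..<n}" r k] assms(1) by simp
  from LeastI_ex[OF this] obtain H where H: "uniform_hypergraph r {..<n} H"
    "crosses_all_k_partitions k {..<n} H" "card H = min_crossing_edges n k r"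
    unfolding min_crossing_edges_def by blast
  have "(n choose d) * (n - d - 1) \<le> card H * (r choose d) * (r - d - 1)"
    using card_crossing_hypergraph_times_binomial_ge[of "{..<n}" r H d] H assms k by simp
  then have "real ((n choose d) * (n - d - 1)) \<le> real (card H * (r choose d) * (r - d - 1))"
    by (rule of_nat_mono)
  then have count: "real (n choose d) * (real n - real d - 1)
      \<le> real (card H) * (real (r choose d) * (real r - real d - 1))"
    using assms k by (simp add: of_nat_diff mult.assoc diff_diff_eq add.commute)
  have pos: "real (r choose d) > 0" "real r - real d - 1 > 0" "real r - real d > 0"
    "real n - real d > 0"
    using assms k by simp_all
  have nonzero: "(real d + 2) * (real d + 1) \<noteq> 0"
    by (smt (verit) mult_eq_0_iff of_nat_0_le_iff)
  have absorbed: "real (m choose k) = real (m choose d) * (real m - real d) * (real m - real d - 1)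
      / ((real d + 2) * (real d + 1))" if "m \<ge> k" for m
    using that unfolding k nonzero_eq_divide_eq[OF nonzero] by (rule binomial_absorb_twice)
  have "real (n choose k) / real (r choose k) * ((real r - real k + 2) / (real n - real k + 2))
      = real (n choose d) * (real n - real d - 1) / (real (r choose d) * (real r - real d - 1))"
  proof -
    have shift: "real r - real k + 2 = real r - real d" "real n - real k + 2 = real n - real d"
      using k by simp_all
    have cancel: "(a * u * v / c) / (b * w * z / c) * (w / u) = a * v / (b * z)"
      if "u \<noteq> 0" "w \<noteq> 0" "c \<noteq> 0" for a b c u v w z :: real
      using that by simp
    show ?thesis
      unfolding absorbed[OF assms(2)] absorbed[OF le_trans[OF assms(2,1)]] shift
      by (rule cancel[OF _ _ nonzero]) (use pos in simp_all)
  qed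
  also have "\<dots> \<le> real (card H)"
    using count pos by (simp add: pos_divide_le_eq)
  finally show ?thesis
    using H(3) by simp
qed

end
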